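(* For every integer $n \geq 1$, the differential $d_n : \mathbb{C}C_n \otimes \mathrm{TL}_3 \to \mathbb{C}C_{n-1} \otimes \mathrm{TL}_3$ of the Anick resolution of the Temperley-Lieb algebra $\mathrm{TL}_3 = \mathrm{TL}_3(\tau)$ depends on $\tau$, in the following sense: there is an $n$-chain $c \in C_n$ such that, when $d_n(c \otimes 1)$ is expanded in the $\mathbb{C}$-basis $\{f \otimes s : f \in C_{n-1},\ s \in N\}$ of $\mathbb{C}C_{n-1} \otimes \mathrm{TL}_3$ (where $N=\{1,e_1,e_2,e_1e_2,e_2e_1\}$ is the set of normal words), at least one of the coefficients is a non-constant function of $\tau \in \mathbb{C}$.
   Context: For $\tau \in \mathbb{C}$, $\mathrm{TL}_3=\mathrm{TL}_3(\tau)$ is the associative unital $\mathbb{C}$-algebra generated by $e_1, e_2$ with relations $e_1e_2e_1 = e_1$, $e_2e_1e_2 = e_2$, $e_1e_1 = \tau e_1$, $e_2e_2 = \tau e_2$, with augmentation $\epsilon:\mathrm{TL}_3\to\mathbb{C}$, $\epsilon(e_1)=\epsilon(e_2)=0$. With respect to the degree-lexicographic (DEGLEX) order with $1<e_1<e_2$, these relations form a Gröbner basis, with leading words (obstructions) $e_1e_2e_1,\ e_2e_1e_2,\ e_1e_1,\ e_2e_2$. A word in $e_1,e_2$ is normal if it contains no obstruction as a (contiguous) subword; the normal words $N=\{1,e_1,e_2,e_1e_2,e_2e_1\}$ form a $\mathbb{C}$-basis of $\mathrm{TL}_3(\tau)$ for every $\tau$. Chains. Put $C_{-1} = \{1\}$.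 The $0$-chains are the letters $e_1, e_2$, each being its own tail. For $n\ge 1$, an $n$-chain is a word $w = g t$, where $g$ is an $(n-1)$-chain with tail $r$, $t$ is a nonempty normal word, and the word $rt$ contains exactly one occurrence of an obstruction as a subword, this occurrence being a suffix of $rt$; the tail of $w$ is $t$. $C_n$ is the set of $n$-chains and $\mathbb{C}C_n$ the vector space with basis $C_n$. The sets $C_n$ do not depend on $\tau$. For every $\tau$, $\mathbb{C}C_n\otimes \mathrm{TL}_3(\tau)$ is a free right $\mathrm{TL}_3(\tau)$-module with $\mathbb{C}$-basis $\{f\otimes s: f\in C_n, s\in N\}$. These basis elements are ordered by comparing the concatenated words $fs$ in the DEGLEX order; the leading term of a nonzero element is its largest basis element occurring with nonzero coefficient, and the leading coefficient is the coefficient of that term. Anick resolution. This is the free resolution $$\cdots \to \mathbb{C}C_n\otimes \mathrm{TL}_3 \xrightarrow{d_n} \mathbb{C}C_{n-1}\otimes \mathrm{TL}_3 \to\cdots\to \mathbb{C}C_0\otimes \mathrm{TL}_3\xrightarrow{d_0} \mathbb{C}C_{-1}\otimes \mathrm{TL}_3\xrightarrow{\epsilon}\mathbb{C}\to 0$$ of right modules, with $\mathbb{C}$-linear splitting maps $i_n:\ker d_{n-1}\to \mathbb{C}C_n\otimes \mathrm{TL}_3$ (where $d_{-1}=\epsilon$), defined recursively by: - $d_0(x\otimes 1) = 1\otimes x$ for $x\in\{e_1,e_2\}$; - $i_0(1\otimes x_1x_2\cdots x_m) = x_1\otimes x_2\cdots x_m$ for a nonempty normal word $x_1\cdots x_m$,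 extended linearly; - for $n\ge 0$ and every $(n+1)$-chain $gt$ with tail $t$ (and $g$ an $n$-chain): $d_{n+1}(gt\otimes 1) = g\otimes t - i_n\big(d_n(g\otimes t)\big)$, extended to a right module homomorphism; - for $n\ge1$: $i_n(0)=0$, and for nonzero $u\in\ker d_{n-1}$ with leading term $f\otimes s$ and leading coefficient $\alpha$, $i_n(u) = \alpha\, g\otimes c + i_n\big(u - \alpha\, d_n(g\otimes c)\big)$, where $g\in C_n$ and $c\in N$ are determined by the equality of words $gc = fs$. *)

theory Defs
  imports Complex_Main "HOL-Library.Poly_Mapping" "HOL-Algebra.QuotRing"
begin

section \<open>The Temperley--Lieb algebra on three strands\<close>

datatype letter = E1 | E2

type_synonym word = "letter list"

text \<open>Words form a monoid under concatenation. With this instance the convolution product on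
  \<^typ>\<open>word \<Rightarrow>\<^sub>0 complex\<close> is the product of the free algebra on the two letters.\<close>

instantiation list :: (type) monoid_add
begin
definition zero_list :: "'a list" where "zero_list = []"
definition plus_list :: "'a list \<Rightarrow> 'a list \<Rightarrow> 'a list" where "plus_list = (@)"
instance by standard (simp_all add: zero_list_def plus_list_def)
end

type_synonym free_elt = "word \<Rightarrow>\<^sub>0 complex"

definition scale :: "complex \<Rightarrow> ('k \<Rightarrow>\<^sub>0 complex) \<Rightarrow> ('k \<Rightarrow>\<^sub>0 complex)" where
  "scale \<alpha> u = Poly_Mapping.map (\<lambda>x. \<alpha> * x) u"

definition free_alg :: "free_elt ring" where
  "free_alg = \<lparr>carrier = UNIV, mult = (*), one = 1, zero = 0, add = (+)\<rparr>"

definition gen :: "letter \<Rightarrow> free_elt" where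
  "gen x = Poly_Mapping.single [x] 1"

definition tl_relations :: "complex \<Rightarrow> free_elt set" where
  "tl_relations \<tau> =
     {gen E1 * gen E2 * gen E1 - gen E1,
      gen E2 * gen E1 * gen E2 - gen E2,
      gen E1 * gen E1 - scale \<tau> (gen E1),
      gen E2 * gen E2 - scale \<tau> (gen E2)}"

definition tl_ideal :: "complex \<Rightarrow> free_elt set" where
  "tl_ideal \<tau> = Idl\<^bsub>free_alg\<^esub> (tl_relations \<tau>)"

definition TL3 :: "complex \<Rightarrow> free_elt set ring" where
  "TL3 \<tau> = free_alg Quot (tl_ideal \<tau>)"

definition tl_class :: "complex \<Rightarrow> free_elt \<Rightarrow> free_elt set" where
  "tl_class \<tau> p = tl_ideal \<tau> +>\<^bsub>free_alg\<^esub> p"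

section \<open>Obstructions, normal words and chains\<close>

definition deglex :: "(word \<times> word) set" where
  "deglex = lenlex {(E1, E2)}"

definition obstructions :: "word set" where
  "obstructions = {[E1, E2, E1], [E2, E1, E2], [E1, E1], [E2, E2]}"

definition occurrences :: "word \<Rightarrow> (word \<times> word \<times> word) set" where
  "occurrences w = {(u, b, v). b \<in> obstructions \<and> w = u @ b @ v}"

definition normal_words :: "word set" where
  "normal_words = {w. occurrences w = {}}"

text \<open>\<^term>\<open>tl_coords \<tau> x\<close> lists the coordinates of an element of \<open>TL3 \<tau>\<close> in the
  basis of normal words.\<close>

definition tl_coords :: "complex \<Rightarrow> free_elt set \<Rightarrow> free_elt" where
  "tl_coords \<tau> x = (THE q. Poly_Mapping.keys q \<subseteq> normal_words \<and> tl_class \<tau> q = x)"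

text \<open>\<^term>\<open>chain n w t\<close>: the word \<open>w\<close> is an \<open>n\<close>-chain with tail \<open>t\<close>. The remaining set
  \<open>C\<^sub>-\<^sub>1 = {1}\<close> of chains is not covered by the index; it is represented by the empty word in
  the definitions of \<open>d\<^sub>0\<close> and \<open>i\<^sub>0\<close> below.\<close>

inductive chain :: "nat \<Rightarrow> word \<Rightarrow> word \<Rightarrow> bool" where
  chain_0: "chain 0 [x] [x]"
| chain_Suc: "chain n g r \<Longrightarrow> t \<in> normal_words \<Longrightarrow> t \<noteq> [] \<Longrightarrow>
    occurrences (r @ t) = {(u, b, [])} \<Longrightarrow> chain (Suc n) (g @ t) t"

definition anick_chains :: "nat \<Rightarrow> word set" where
  "anick_chains n = {w. \<exists>t. chain n w t}"

section \<open>The Anick resolution\<close>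

text \<open>An element of \<open>\<complex>C\<^sub>n \<otimes> TL3 \<tau>\<close> is given by its coordinates in the
  basis \<open>f \<otimes> s\<close> with \<open>f\<close> in \<open>C\<^sub>n\<close> and \<open>s\<close> a normal word.\<close>

type_synonym tmod = "(word \<times> word) \<Rightarrow>\<^sub>0 complex"

definition bas :: "word \<Rightarrow> word \<Rightarrow> tmod" where
  "bas f s = Poly_Mapping.single (f, s) 1"

definition lin_ext :: "(word \<times> word \<Rightarrow> tmod) \<Rightarrow> tmod \<Rightarrow> tmod" where
  "lin_ext \<phi> u = (\<Sum>b\<in>Poly_Mapping.keys u. scale (Poly_Mapping.lookup u b) (\<phi> b))"

definition tensor :: "complex \<Rightarrow> word \<Rightarrow> free_elt set \<Rightarrow> tmod" where
  "tensor \<tau> f x = (\<Sum>s\<in>normal_words. scale (Poly_Mapping.lookup (tl_coords \<tau> x) s) (bas f s))"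

definition ract :: "complex \<Rightarrow> tmod \<Rightarrow> free_elt set \<Rightarrow> tmod" where
  "ract \<tau> u x =
     lin_ext (\<lambda>(f, s). tensor \<tau> f (tl_class \<tau> (Poly_Mapping.single s 1) \<otimes>\<^bsub>TL3 \<tau>\<^esub> x)) u"

text \<open>The right module homomorphism with prescribed values on the generators \<open>w \<otimes> 1\<close>.\<close>

definition mod_hom :: "complex \<Rightarrow> (word \<Rightarrow> tmod) \<Rightarrow> tmod \<Rightarrow> tmod" where
  "mod_hom \<tau> \<delta> =
     lin_ext (\<lambda>(w, s). ract \<tau> (\<delta> w) (tl_class \<tau> (Poly_Mapping.single s 1)))"

definition lead_term :: "tmod \<Rightarrow> word \<times> word" where
  "lead_term u = (THE (f, s). (f, s) \<in> Poly_Mapping.keys u \<and>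
     (\<forall>(f', s') \<in> Poly_Mapping.keys u. (f', s') = (f, s) \<or> (f' @ s', f @ s) \<in> deglex))"

definition lead_coeff_tmod :: "tmod \<Rightarrow> complex" where
  "lead_coeff_tmod u = Poly_Mapping.lookup u (lead_term u)"

definition refactor :: "nat \<Rightarrow> word \<times> word \<Rightarrow> word \<times> word" where
  "refactor n = (\<lambda>(f, s). THE (g, c). g \<in> anick_chains n \<and> c \<in> normal_words \<and> g @ c = f @ s)"

text \<open>The splitting map \<open>i\<^sub>n\<close>, where the argument \<open>d\<close> stands for \<open>d\<^sub>n\<close>. It is a map on
  \<open>ker d\<^sub>n\<^sub>-\<^sub>1\<close>, and the recursion is only meaningful there: outside its domain of termination the
  value is unspecified.\<close>

function (domintros) split_map :: "nat \<Rightarrow> (tmod \<Rightarrow> tmod) \<Rightarrow> tmod \<Rightarrow> tmod" where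
  "split_map 0 d u = lin_ext (\<lambda>(f, s). bas [hd s] (tl s)) u"
| "split_map (Suc n) d u =
     (if u = 0 then 0
      else let (g, c) = refactor (Suc n) (lead_term u);
               v = scale (lead_coeff_tmod u) (bas g c)
           in v + split_map (Suc n) d (u - scale (lead_coeff_tmod u) (d (bas g c))))"
  by pat_completeness auto

text \<open>\<^term>\<open>anick_gen \<tau> n w\<close> is \<open>d\<^sub>n (w \<otimes> 1)\<close> for an \<open>n\<close>-chain \<open>w\<close>.\<close>

definition chain_split :: "nat \<Rightarrow> word \<Rightarrow> word \<times> word" where
  "chain_split n w = (THE (g, t). g \<in> anick_chains n \<and> chain (Suc n) w t \<and> w = g @ t)"

primrec anick_gen :: "complex \<Rightarrow> nat \<Rightarrow> word \<Rightarrow> tmod" where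
  "anick_gen \<tau> 0 w = bas [] w"
| "anick_gen \<tau> (Suc n) w =
     (let (g, t) = chain_split n w;
          d = mod_hom \<tau> (anick_gen \<tau> n)
      in bas g t - split_map n d (d (bas g t)))"

definition anick_d :: "complex \<Rightarrow> nat \<Rightarrow> tmod \<Rightarrow> tmod" where
  "anick_d \<tau> n = mod_hom \<tau> (anick_gen \<tau> n)"

end

theory Submission
  imports Defs
begin

text \<open>Writing \<open>a, b\<close> for the two letters, the recursion for the differential can be solved on the
  chains \<open>a\<^sup>n\<^sup>+\<^sup>1\<close> and \<open>a\<^sup>nba\<close>. For odd \<open>n\<close>
    \<open>d\<^sub>n (a\<^sup>n\<^sup>+\<^sup>1 \<otimes> 1) = a\<^sup>n \<otimes> a - \<tau> a\<^sup>n \<otimes> 1\<close> and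
    \<open>d\<^sub>n (a\<^sup>nba \<otimes> 1) = a\<^sup>n \<otimes> ba - a\<^sup>n \<otimes> 1\<close>,
  while for even \<open>n\<close>
    \<open>d\<^sub>n (a\<^sup>n\<^sup>+\<^sup>1 \<otimes> 1) = a\<^sup>n \<otimes> a\<close> and, if \<open>n > 0\<close>,
    \<open>d\<^sub>n (a\<^sup>nba \<otimes> 1) = a\<^sup>n \<otimes> ba + \<tau> a\<^sup>n\<^sup>-\<^sup>1ba \<otimes> 1 - a\<^sup>n \<otimes> 1\<close>.
  So \<open>\<tau>\<close> occurs as a coefficient on \<open>a\<^sup>n\<^sup>+\<^sup>1\<close> for odd \<open>n\<close> and on \<open>a\<^sup>nba\<close> for even \<open>n\<close>.
  That coordinates in \<open>TL3\<close> are well defined follows from the action of the free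
  algebra by left multiplication on the span of the normal words, on which the ideal of relations
  acts as zero.\<close>

section \<open>Linear combinations\<close>

lemma lookup_scale [simp]: "Poly_Mapping.lookup (scale \<alpha> u) k = \<alpha> * Poly_Mapping.lookup u k"
  by (simp add: scale_def Poly_Mapping.map.rep_eq when_def)

lemma scale_simps [simp]:
  "scale \<alpha> 0 = 0" "scale 0 u = 0" "scale 1 u = u" "scale \<alpha> (scale \<beta> u) = scale (\<alpha> * \<beta>) u"
  "scale \<alpha> (Poly_Mapping.single k c) = Poly_Mapping.single k (\<alpha> * c)"
  by (auto intro!: poly_mapping_eqI simp: lookup_single when_def)

lemma scale_add: "scale \<alpha> (u + v) = scale \<alpha> u + scale \<alpha> v"
  and scale_add_left: "scale (\<alpha> + \<beta>) u = scale \<alpha> u + scale \<beta> u"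
  and scale_diff: "scale \<alpha> (u - v) = scale \<alpha> u - scale \<alpha> v"
  and scale_minus_left: "scale (- \<alpha>) u = - scale \<alpha> u"
  by (auto intro!: poly_mapping_eqI simp: lookup_add lookup_minus algebra_simps)

text \<open>An update at a key outside the support is the addition of a \<open>single\<close>, so
  linear identities need checking on basis elements only.\<close>

lemma poly_mapping_single_induct [case_names zero single_add]:
  fixes u :: "'a \<Rightarrow>\<^sub>0 complex"
  assumes "P 0" and "\<And>k c u. P u \<Longrightarrow> P (Poly_Mapping.single k c + u)"
  shows "P u"
proof (induction u rule: update_induct)
  case const
  then show ?case using assms(1) by simp
next
  case (update u k c)
  have "Poly_Mapping.update k c u = Poly_Mapping.single k c + u"
    using update.hyps
    by (intro poly_mapping_eqI)
      (auto simp: lookup_update lookup_add lookup_single when_def in_keys_iff)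
  then show ?case using assms(2) update by metis
qed

text \<open>The formula of \<open>lin_ext\<close> at general index types, so that the same linearity
  rules serve the algebra and the modules.\<close>

definition linear_extension :: "('a \<Rightarrow> ('b \<Rightarrow>\<^sub>0 complex)) \<Rightarrow> ('a \<Rightarrow>\<^sub>0 complex) \<Rightarrow> ('b \<Rightarrow>\<^sub>0 complex)" where
  "linear_extension \<phi> u = (\<Sum>b\<in>Poly_Mapping.keys u. scale (Poly_Mapping.lookup u b) (\<phi> b))"

lemma linear_extension_superset:
  assumes "finite A" "Poly_Mapping.keys u \<subseteq> A"
  shows "linear_extension \<phi> u = (\<Sum>b\<in>A. scale (Poly_Mapping.lookup u b) (\<phi> b))"
  unfolding linear_extension_def
  by (rule sum.mono_neutral_left) (use assms in \<open>auto simp: in_keys_iff\<close>)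

lemma linear_extension_add:
  "linear_extension \<phi> (u + v) = linear_extension \<phi> u + linear_extension \<phi> v"
proof -
  let ?A = "Poly_Mapping.keys u \<union> Poly_Mapping.keys v"
  show ?thesis
    using keys_add[of u v]
    by (simp add: linear_extension_superset[of ?A] lookup_add sum.distrib scale_add_left)
qed

lemma linear_extension_zero [simp]: "linear_extension \<phi> 0 = 0"
  by (simp add: linear_extension_def)

lemma linear_extension_single [simp]:
  "linear_extension \<phi> (Poly_Mapping.single k c) = scale c (\<phi> k)"
  by (simp add: linear_extension_superset[of "{k}"])

lemma linear_extension_scale:
  "linear_extension \<phi> (scale c u) = scale c (linear_extension \<phi> u)"
  by (induction u rule: poly_mapping_single_induct) (simp_all add: linear_extension_add scale_add)

lemma linear_extension_diff:
  "linear_extension \<phi> (u - v) = linear_extension \<phi> u - linear_extension \<phi> v"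
  using linear_extension_add[of \<phi> "u - v" v] by simp

lemma linear_extension_comp:
  "linear_extension \<phi> (linear_extension \<psi> u) = linear_extension (\<lambda>b. linear_extension \<phi> (\<psi> b)) u"
  by (induction u rule: poly_mapping_single_induct)
    (simp_all add: linear_extension_add linear_extension_scale)

lemma linear_extension_fun_scale:
  "linear_extension (\<lambda>b. scale c (\<phi> b)) u = scale c (linear_extension \<phi> u)"
  by (induction u rule: poly_mapping_single_induct)
    (simp_all add: linear_extension_add scale_add mult.commute)

lemma linear_extension_basis: "linear_extension (\<lambda>b. Poly_Mapping.single b 1) u = u"
  by (induction u rule: poly_mapping_single_induct) (simp_all add: linear_extension_add)

lemma lin_ext_eq: "lin_ext = linear_extension"
  by (intro ext) (simp add: lin_ext_def linear_extension_def)

section \<open>Normal words\<close>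

lemma occurrences_append:
  "(u, b, v) \<in> occurrences w \<Longrightarrow> (u, b, v @ z) \<in> occurrences (w @ z)"
  by (auto simp: occurrences_def)

text \<open>An occurrence starts at the first letter or lies behind it; as a rewrite rule this
  computes \<open>occurrences\<close> of explicit words.\<close>

lemma occurrences_Cons:
  "occurrences (x # w) = (\<lambda>(u, b, v). (x # u, b, v)) ` occurrences w \<union>
     {([], b, v) | b v. b \<in> obstructions \<and> x # w = b @ v}"
  (is "?L = ?R")
proof
  show "?L \<subseteq> ?R"
    by (force simp: occurrences_def append_eq_Cons_conv Cons_eq_append_conv)
  show "?R \<subseteq> ?L"
    by (auto simp: occurrences_def)
qed

lemma occurrences_Nil: "occurrences [] = {}"
  by (auto simp: occurrences_def obstructions_def)

lemma occurrences_E1_E1: "occurrences [E1, E1] = {([], [E1, E1], [])}"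
  and occurrences_E1_E2_E1: "occurrences [E1, E2, E1] = {([], [E1, E2, E1], [])}"
  by (auto simp: occurrences_Cons occurrences_Nil obstructions_def)

lemma normal_words_eq: "normal_words = {[], [E1], [E2], [E1, E2], [E2, E1]}"
proof
  show "{[], [E1], [E2], [E1, E2], [E2, E1]} \<subseteq> normal_words"
    by (auto simp: normal_words_def occurrences_Cons occurrences_Nil obstructions_def)
  show "normal_words \<subseteq> {[], [E1], [E2], [E1, E2], [E2, E1]}"
  proof
    fix w assume "w \<in> normal_words"
    then have no: "w \<noteq> u @ b @ v" if "b \<in> obstructions" for u b v
      using that by (force simp: normal_words_def occurrences_def)
    show "w \<in> {[], [E1], [E2], [E1, E2], [E2, E1]}"
    proof (cases "length w < 3")
      case True
      then consider "w = []" | x where "w = [x]" | x y where "w = [x, y]"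
        by (cases w; cases "tl w") (auto simp: length_Suc_conv)
      then show ?thesis
      proof cases
        case (3 x y)
        then show ?thesis
          using no[of "[x, y]" "[]" "[]"]
          by (cases x; cases y) (auto simp: obstructions_def)
      qed (use letter.exhaust in auto)
    next
      case False
      \<comment> \<open>Three consecutive letters out of two either contain a square or alternate;
        both cases give an obstruction.\<close>
      then obtain x y z v where "w = x # y # z # v"
        by (metis One_nat_def Suc_1 length_Cons less_Suc_eq_0_disj list.exhaust list.size(3) numeral_3_eq_3)
      then show ?thesis
        using no[of "[x, y]" "[]" "z # v"] no[of "[y, z]" "[x]" v] no[of "[x, y, z]" "[]" v]
        by (cases x; cases y; cases z) (auto simp: obstructions_def)
    qed
  qed
qed

section \<open>The algebra and its normal form\<close>

text \<open>Left multiplication by a letter on the span of the normal words. In the last branch \<open>x # s\<close> is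
  \<open>x y x\<close>, which reduces to \<open>x\<close>; abnormal words are sent to 0 as junk, so that the
  relations hold on the whole of the free module on words.\<close>

definition letter_mult :: "complex \<Rightarrow> letter \<Rightarrow> word \<Rightarrow> free_elt" where
  "letter_mult \<tau> x s =
     (if s \<notin> normal_words then 0
      else if x # s \<in> normal_words then Poly_Mapping.single (x # s) 1
      else if hd s = x then Poly_Mapping.single s \<tau>
      else Poly_Mapping.single (tl s) 1)"

definition word_act :: "complex \<Rightarrow> word \<Rightarrow> free_elt \<Rightarrow> free_elt" where
  "word_act \<tau> w v = foldr (\<lambda>x. linear_extension (letter_mult \<tau> x)) w v"

definition rep :: "complex \<Rightarrow> free_elt \<Rightarrow> free_elt \<Rightarrow> free_elt" where
  "rep \<tau> p v = linear_extension (\<lambda>w. word_act \<tau> w v) p"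

lemma word_act_zero: "word_act \<tau> w 0 = 0"
  and word_act_add: "word_act \<tau> w (u + v) = word_act \<tau> w u + word_act \<tau> w v"
  and word_act_scale: "word_act \<tau> w (scale c v) = scale c (word_act \<tau> w v)"
  by (induction w) (simp_all add: word_act_def linear_extension_add linear_extension_scale)

lemma word_act_append: "word_act \<tau> (w @ w') v = word_act \<tau> w (word_act \<tau> w' v)"
  by (simp add: word_act_def)

lemma rep_single: "rep \<tau> (Poly_Mapping.single w c) v = scale c (word_act \<tau> w v)"
  and rep_add: "rep \<tau> (p + q) v = rep \<tau> p v + rep \<tau> q v"
  and rep_diff: "rep \<tau> (p - q) v = rep \<tau> p v - rep \<tau> q v"
  and rep_zero: "rep \<tau> 0 v = 0"
  by (simp_all add: rep_def linear_extension_add linear_extension_diff)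

lemma rep_zero_right: "rep \<tau> p 0 = 0"
  by (induction p rule: poly_mapping_single_induct)
    (simp_all add: rep_single rep_add rep_zero word_act_zero)

lemma rep_mult: "rep \<tau> (p * q) v = rep \<tau> p (rep \<tau> q v)"
proof (induction p rule: poly_mapping_single_induct)
  case (single_add w c p)
  have "rep \<tau> (Poly_Mapping.single w c * q) v = scale c (word_act \<tau> w (rep \<tau> q v))"
    by (induction q rule: poly_mapping_single_induct)
      (simp_all add: rep_zero rep_add rep_single word_act_zero word_act_add word_act_scale
        distrib_left mult_single plus_list_def word_act_append scale_add)
  then show ?case
    using single_add by (simp add: distrib_right rep_add rep_single)
qed (simp add: rep_zero)

text \<open>Suffixes of a normal word are normal, so building it letter by letter from the empty
  word triggers no reduction. This yields the linear independence of normal words modulo the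
  relations.\<close>

lemma rep_normal_words:
  assumes "Poly_Mapping.keys q \<subseteq> normal_words"
  shows "rep \<tau> q (Poly_Mapping.single [] 1) = q"
proof -
  have "word_act \<tau> w (Poly_Mapping.single [] 1) = Poly_Mapping.single w 1"
    if "w \<in> normal_words" for w
    using that by (auto simp: normal_words_eq word_act_def letter_mult_def)
  then have "rep \<tau> q (Poly_Mapping.single [] 1) = linear_extension (\<lambda>w. Poly_Mapping.single w 1) q"
    unfolding rep_def linear_extension_def using assms by (intro sum.cong) auto
  then show ?thesis
    by (simp add: linear_extension_basis)
qed

section \<open>Passage to the quotient by the ideal of relations\<close>

lemma free_alg_simps [simp]:
  "carrier free_alg = UNIV" "x \<otimes>\<^bsub>free_alg\<^esub> y = x * y" "\<one>\<^bsub>free_alg\<^esub> = 1"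
  "\<zero>\<^bsub>free_alg\<^esub> = 0" "x \<oplus>\<^bsub>free_alg\<^esub> y = x + y"
  by (simp_all add: free_alg_def)

interpretation free_alg: ring free_alg
proof (rule ringI)
  show "abelian_group free_alg"
  proof (rule abelian_groupI)
    show "\<exists>y\<in>carrier free_alg. y \<oplus>\<^bsub>free_alg\<^esub> x = \<zero>\<^bsub>free_alg\<^esub>" for x
      by (rule bexI[of _ "- x"]) auto
  qed (auto simp: algebra_simps)
  show "Group.monoid free_alg"
    by (rule monoidI) (auto simp: algebra_simps)
qed (auto simp: algebra_simps)

lemma free_alg_uminus [simp]: "\<ominus>\<^bsub>free_alg\<^esub> x = - x"
  by (rule free_alg.minus_equality) auto

lemma free_alg_minus [simp]: "x \<ominus>\<^bsub>free_alg\<^esub> y = x - y"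
  by (simp add: a_minus_def)

lemma ideal_tl_ideal: "ideal (tl_ideal \<tau>) free_alg"
  unfolding tl_ideal_def by (rule free_alg.genideal_ideal) simp

lemma tl_class_eq_iff: "tl_class \<tau> p = tl_class \<tau> q \<longleftrightarrow> p - q \<in> tl_ideal \<tau>"
  using free_alg.quotient_eq_iff_same_a_r_cos[OF ideal_tl_ideal, of p q \<tau>]
  by (simp add: tl_class_def)

lemma tl_class_mult: "tl_class \<tau> p \<otimes>\<^bsub>TL3 \<tau>\<^esub> tl_class \<tau> q = tl_class \<tau> (p * q)"
  using ideal.rcoset_mult_add[OF ideal_tl_ideal, of p q \<tau>]
  by (simp add: TL3_def FactRing_def tl_class_def)

lemma rep_tl_relations:
  assumes "p \<in> tl_relations \<tau>"
  shows "rep \<tau> p v = 0"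
proof -
  have letters: "word_act \<tau> [x] v = linear_extension (letter_mult \<tau> x) v" for x v
    by (simp add: word_act_def)
  have braid: "rep \<tau> (gen x * gen y * gen x - gen x) v = 0" if "x \<noteq> y" for x y
  proof -
    \<comment> \<open>By linearity a single word \<open>s\<close> suffices: abnormal words are
      killed by every letter, and the five normal ones are checked directly.\<close>
    have "linear_extension (letter_mult \<tau> x) (linear_extension (letter_mult \<tau> y) (letter_mult \<tau> x s))
        = letter_mult \<tau> x s" for s
      using that
      by (cases "s \<in> normal_words"; cases x; cases y)
        (auto simp: letter_mult_def normal_words_eq linear_extension_def)
    then show ?thesis
      by (simp add: gen_def rep_diff rep_mult rep_single letters linear_extension_comp)
  qed
  have square: "rep \<tau> (gen x * gen x - scale \<tau> (gen x)) v = 0" for x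
  proof -
    have "linear_extension (letter_mult \<tau> x) (letter_mult \<tau> x s) = scale \<tau> (letter_mult \<tau> x s)" for s
      by (cases "s \<in> normal_words"; cases x)
        (auto simp: letter_mult_def normal_words_eq linear_extension_def)
    then show ?thesis
      by (simp add: gen_def rep_diff rep_mult rep_single letters linear_extension_comp
        linear_extension_fun_scale)
  qed
  show ?thesis
    using assms braid square by (auto simp: tl_relations_def)
qed

lemma rep_tl_ideal:
  assumes "p \<in> tl_ideal \<tau>"
  shows "rep \<tau> p v = 0"
proof -
  \<comment> \<open>Zero action on all \<open>v\<close> makes the kernel two-sided: in a product
    \<open>p * q\<close> the factor \<open>p\<close> acts on \<open>rep \<tau> q v\<close>.\<close>
  let ?K = "{p. \<forall>v. rep \<tau> p v = 0}"
  have "ideal ?K free_alg"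
  proof (rule idealI)
    show "ring free_alg" ..
    show "subgroup ?K (add_monoid free_alg)"
    proof (rule free_alg.add.subgroupI)
      show "\<ominus>\<^bsub>free_alg\<^esub> p \<in> ?K" if "p \<in> ?K" for p
        using that rep_diff[of \<tau> 0 p] by (simp add: rep_zero)
    qed (auto simp: rep_add rep_zero intro: exI[of _ 0])
  qed (auto simp: rep_mult rep_zero_right)
  then have "tl_ideal \<tau> \<subseteq> ?K"
    unfolding tl_ideal_def using rep_tl_relations
    by (intro free_alg.genideal_minimal) auto
  then show ?thesis using assms by auto
qed

text \<open>Uniqueness behind \<open>THE\<close>: two normal representatives of a class act alike on
  the empty word, and \<open>rep_normal_words\<close> recovers each of them from that.\<close>

lemma tl_coords_tl_class:
  assumes "Poly_Mapping.keys q \<subseteq> normal_words" and "p - q \<in> tl_ideal \<tau>"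
  shows "tl_coords \<tau> (tl_class \<tau> p) = q"
  unfolding tl_coords_def
proof (rule the_equality)
  have pq: "tl_class \<tau> p = tl_class \<tau> q"
    using assms(2) by (simp add: tl_class_eq_iff)
  then show "Poly_Mapping.keys q \<subseteq> normal_words \<and> tl_class \<tau> q = tl_class \<tau> p"
    using assms(1) by simp
  fix q' assume q': "Poly_Mapping.keys q' \<subseteq> normal_words \<and> tl_class \<tau> q' = tl_class \<tau> p"
  then have "q' - q \<in> tl_ideal \<tau>"
    using pq tl_class_eq_iff by metis
  then have "rep \<tau> q' (Poly_Mapping.single [] 1) = rep \<tau> q (Poly_Mapping.single [] 1)"
    using rep_tl_ideal[of "q' - q"] by (simp add: rep_diff)
  then show "q' = q"
    using q' assms(1) by (simp add: rep_normal_words)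
qed


section \<open>Chains\<close>

text \<open>For each \<open>n\<close> the \<open>n\<close>-chains form a prefix code: if one of two tails \<open>t\<close>, \<open>t'\<close> following the
  same chain were a proper prefix of the other, the obstruction ending the shorter one would be an
  occurrence that does not end the longer one.\<close>

lemma chain_prefix_code:
  assumes "chain n w t" "chain n w' t'" "w @ x = w' @ y"
  shows "w = w' \<and> t = t'"
  using assms
proof (induction n w t arbitrary: w' t' x y rule: chain.induct)
  case (chain_0 a)
  from chain_0(1) show ?case
    by cases (use chain_0(2) in auto)
next
  case (chain_Suc n g r t u b)
  from chain_Suc.prems(1) obtain g' r' u' b' where
    w': "w' = g' @ t'" "chain n g' r'" "occurrences (r' @ t') = {(u', b', [])}"
    by cases auto
  have eq: "g = g'" "r = r'"
    using chain_Suc.IH[of g' r' "t @ x" "t' @ y"] w' chain_Suc.prems(2) by auto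
  have no_ext: "z = []"
    if "occurrences (r @ t1) = {(u1, b1, [])}" "occurrences (r @ t1 @ z) = {(u2, b2, [])}"
    for t1 u1 b1 z u2 b2
    using occurrences_append[of u1 b1 "[]" "r @ t1" z] that by simp
  from chain_Suc.prems(2) w'(1) eq have "t @ x = t' @ y" by simp
  then obtain z where "t = t' @ z \<or> t' = t @ z"
    by (auto simp: append_eq_append_conv2)
  then have "t = t'"
  proof
    assume t: "t = t' @ z"
    have "z = []"
      by (rule no_ext[of t' u' b' z u b]) (use chain_Suc.hyps(4) w'(3) eq t in simp_all)
    then show ?thesis using t by simp
  next
    assume t': "t' = t @ z"
    have "z = []"
      by (rule no_ext[of t u b z u' b']) (use chain_Suc.hyps(4) w'(3) eq t' in simp_all)
    then show ?thesis using t' by simp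
  qed
  then show ?case using eq w'(1) by simp
qed

lemma anick_chains_prefix_code:
  assumes "g \<in> anick_chains n" "g' \<in> anick_chains n" "g @ x = g' @ y"
  shows "g = g' \<and> x = y"
proof -
  obtain t t' where "chain n g t" "chain n g' t'"
    using assms(1,2) by (auto simp: anick_chains_def)
  then have "g = g'"
    using chain_prefix_code assms(3) by blast
  then show ?thesis using assms(3) by simp
qed

lemma refactor_eq:
  assumes "g \<in> anick_chains n" "c \<in> normal_words" "g @ c = f @ s"
  shows "refactor n (f, s) = (g, c)"
  unfolding refactor_def prod.case
proof (rule the_equality)
  fix p
  assume "case p of (g', c') \<Rightarrow> g' \<in> anick_chains n \<and> c' \<in> normal_words \<and> g' @ c' = f @ s"
  then have "fst p \<in> anick_chains n" "fst p @ snd p = g @ c"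
    using assms(3) by (auto split: prod.splits)
  then show "p = (g, c)"
    using anick_chains_prefix_code[OF _ assms(1)] by (metis prod.collapse)
qed (use assms in auto)

lemma chain_split_eq:
  assumes "g \<in> anick_chains n" "chain (Suc n) (g @ t) t"
  shows "chain_split n (g @ t) = (g, t)"
  unfolding chain_split_def
proof (rule the_equality)
  fix p
  assume "case p of (g', t') \<Rightarrow> g' \<in> anick_chains n \<and> chain (Suc n) (g @ t) t' \<and> g @ t = g' @ t'"
  then have "fst p \<in> anick_chains n" "fst p @ snd p = g @ t"
    by (auto split: prod.splits)
  then show "p = (g, t)"
    using anick_chains_prefix_code[OF _ assms(1)] by (metis prod.collapse)
qed (use assms in auto)

section \<open>Two families of chains: powers of E1, and such powers followed by E2 E1\<close>

abbreviation e1_power :: "nat \<Rightarrow> word" where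
  "e1_power n \<equiv> replicate n E1"

lemma e1_power_append: "e1_power n @ [E1] = e1_power (Suc n)"
  by (simp add: replicate_append_same)

text \<open>The tail \<open>[E1]\<close> followed by \<open>[E1]\<close> is exactly one obstruction,
  so the chain can be prolonged forever.\<close>

lemma chain_e1_power: "chain n (e1_power (Suc n)) [E1]"
proof (induction n)
  case 0
  then show ?case using chain_0[of E1] by simp
next
  case (Suc n)
  then show ?case
    using chain_Suc[of n "e1_power (Suc n)" "[E1]" "[E1]" "[]" "[E1, E1]"]
    by (simp add: occurrences_E1_E1 normal_words_eq e1_power_append del: replicate_Suc)
qed

lemma chain_e1_power_E2_E1: "chain (Suc n) (e1_power (Suc n) @ [E2, E1]) [E2, E1]"
  by (rule chain_Suc[OF chain_e1_power, where u = "[]" and b = "[E1, E2, E1]"])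
    (simp_all add: occurrences_E1_E2_E1 normal_words_eq)

lemma e1_power_in_anick_chains: "e1_power (Suc n) \<in> anick_chains n"
  and e1_power_E2_E1_in_anick_chains: "e1_power (Suc n) @ [E2, E1] \<in> anick_chains (Suc n)"
  unfolding anick_chains_def mem_Collect_eq
  by (rule exI, rule chain_e1_power) (rule exI, rule chain_e1_power_E2_E1)

section \<open>The differential\<close>

text \<open>Every product reduced below is congruent to a multiple of one normal word, so one-term
  coordinates suffice.\<close>

lemma tensor_single:
  assumes "s \<in> normal_words" "p - Poly_Mapping.single s c \<in> tl_ideal \<tau>"
  shows "tensor \<tau> f (tl_class \<tau> p) = scale c (bas f s)"
proof -
  have "tl_coords \<tau> (tl_class \<tau> p) = Poly_Mapping.single s c"
    using assms by (intro tl_coords_tl_class) auto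
  then have "tensor \<tau> f (tl_class \<tau> p)
      = (\<Sum>s'\<in>normal_words. if s' = s then scale c (bas f s) else 0)"
    unfolding tensor_def by (intro sum.cong) (auto simp: lookup_single)
  also have "\<dots> = scale c (bas f s)"
    using assms(1) by (subst sum.delta) (auto simp: normal_words_eq)
  finally show ?thesis .
qed

abbreviation word_class :: "complex \<Rightarrow> word \<Rightarrow> free_elt set" where
  "word_class \<tau> s \<equiv> tl_class \<tau> (Poly_Mapping.single s 1)"

lemma ract_add: "ract \<tau> (u + v) x = ract \<tau> u x + ract \<tau> v x"
  and ract_diff: "ract \<tau> (u - v) x = ract \<tau> u x - ract \<tau> v x"
  and ract_scale: "ract \<tau> (scale c u) x = scale c (ract \<tau> u x)"
  by (simp_all add: ract_def lin_ext_eq linear_extension_add linear_extension_diff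
      linear_extension_scale)

lemma ract_bas: "ract \<tau> (bas f s) (word_class \<tau> t) = tensor \<tau> f (word_class \<tau> (s @ t))"
  by (simp add: ract_def lin_ext_eq bas_def tl_class_mult mult_single plus_list_def)

lemma ract_bas_normal:
  assumes "s @ t \<in> normal_words"
  shows "ract \<tau> (bas f s) (word_class \<tau> t) = bas f (s @ t)"
  using tensor_single[OF assms, of "Poly_Mapping.single (s @ t) 1" 1 \<tau> f]
    additive_subgroup.zero_closed[OF ideal.axioms(1)[OF ideal_tl_ideal[of \<tau>]]]
  by (simp add: ract_bas)

lemma tl_relations_in_tl_ideal: "tl_relations \<tau> \<subseteq> tl_ideal \<tau>"
  unfolding tl_ideal_def by (rule free_alg.genideal_self) simp

lemma ract_E1_E1: "ract \<tau> (bas f [E1]) (word_class \<tau> [E1]) = scale \<tau> (bas f [E1])"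
  and ract_E1_E2_E1: "ract \<tau> (bas f [E1]) (word_class \<tau> [E2, E1]) = bas f [E1]"
proof -
  have "gen E1 * gen E1 - scale \<tau> (gen E1) \<in> tl_ideal \<tau>"
    using tl_relations_in_tl_ideal[of \<tau>] by (auto simp: tl_relations_def)
  then have "tensor \<tau> f (word_class \<tau> [E1, E1]) = scale \<tau> (bas f [E1])"
    by (intro tensor_single) (simp_all add: normal_words_eq gen_def mult_single plus_list_def)
  then show "ract \<tau> (bas f [E1]) (word_class \<tau> [E1]) = scale \<tau> (bas f [E1])"
    by (simp add: ract_bas)
next
  have "gen E1 * gen E2 * gen E1 - gen E1 \<in> tl_ideal \<tau>"
    using tl_relations_in_tl_ideal[of \<tau>] by (auto simp: tl_relations_def)
  then have "tensor \<tau> f (word_class \<tau> [E1, E2, E1]) = scale 1 (bas f [E1])"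
    by (intro tensor_single) (simp_all add: normal_words_eq gen_def mult_single plus_list_def)
  then show "ract \<tau> (bas f [E1]) (word_class \<tau> [E2, E1]) = bas f [E1]"
    by (simp add: ract_bas)
qed

lemmas ract_simps = ract_add ract_diff ract_scale ract_E1_E1 ract_E1_E2_E1 ract_bas_normal
  normal_words_eq

lemma anick_d_bas: "anick_d \<tau> n (bas w s) = ract \<tau> (anick_gen \<tau> n w) (word_class \<tau> s)"
  by (simp add: anick_d_def mod_hom_def lin_ext_eq bas_def)

lemma anick_gen_Suc:
  assumes "g \<in> anick_chains n" "chain (Suc n) (g @ t) t"
  shows "anick_gen \<tau> (Suc n) (g @ t)
    = bas g t - split_map n (anick_d \<tau> n) (anick_d \<tau> n (bas g t))"
  by (simp add: chain_split_eq[OF assms] Let_def flip: anick_d_def)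

section \<open>Evaluation of the partial splitting map\<close>

text \<open>The equations of \<open>split_map\<close> hold only on its domain of termination;
  carrying termination along with the value proves both together.\<close>

definition splits_to :: "nat \<Rightarrow> (tmod \<Rightarrow> tmod) \<Rightarrow> tmod \<Rightarrow> tmod \<Rightarrow> bool" where
  "splits_to n d u v \<longleftrightarrow> split_map_dom (n, d, u) \<and> split_map n d u = v"

lemma splits_to_0: "splits_to 0 d (scale c (bas [] (x # s))) (scale c (bas [x] s))"
proof -
  have "split_map_dom (0, d, u)" for u
    by (rule split_map.domintros)
  then show ?thesis
    by (simp add: splits_to_def split_map.psimps lin_ext_eq linear_extension_scale) (simp add: bas_def)
qed

lemma splits_to_zero: "splits_to (Suc n) d 0 0"
proof -
  have "split_map_dom (Suc n, d, 0)"
    by (rule split_map.domintros) simp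
  then show ?thesis
    by (simp add: splits_to_def split_map.psimps)
qed

text \<open>Longer words are larger in \<open>deglex\<close>. Comparing lengths is enough because
  the leading terms met below are strictly longest.\<close>

lemma lead_term_eq:
  assumes "(f, s) \<in> Poly_Mapping.keys u"
    and "\<And>f' s'. (f', s') \<in> Poly_Mapping.keys u \<Longrightarrow> (f', s') \<noteq> (f, s) \<Longrightarrow>
      length (f' @ s') < length (f @ s)"
  shows "lead_term u = (f, s)"
  unfolding lead_term_def
proof (rule the_equality)
  fix p
  assume p: "case p of (f, s) \<Rightarrow> (f, s) \<in> Poly_Mapping.keys u \<and>
    (\<forall>(f', s')\<in>Poly_Mapping.keys u. (f', s') = (f, s) \<or> (f' @ s', f @ s) \<in> deglex)"
  show "p = (f, s)"
  proof (rule ccontr)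
    assume "p \<noteq> (f, s)"
    then have "length (fst p @ snd p) < length (f @ s)" "(f @ s, fst p @ snd p) \<in> deglex"
      using p assms by (cases p; force)+
    then show False
      by (auto simp: deglex_def lenlex_conv)
  qed
qed (use assms in \<open>force simp: deglex_def lenlex_conv\<close>)

text \<open>Since \<open>\<alpha> = 0\<close> is allowed, the step can be used on an element whose top coefficient is a
  multiple of \<open>\<tau>\<close> without treating \<open>\<tau> = 0\<close> separately.\<close>

lemma splits_to_step:
  assumes lead: "Poly_Mapping.lookup u (f, s) = \<alpha>"
    "\<And>f' s'. (f', s') \<in> Poly_Mapping.keys u \<Longrightarrow> (f', s') \<noteq> (f, s) \<Longrightarrow>
      length (f' @ s') < length (f @ s)"
    and gc: "g \<in> anick_chains (Suc n)" "c \<in> normal_words" "g @ c = f @ s"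
    and rest: "splits_to (Suc n) d (u - scale \<alpha> (d (bas g c))) v"
  shows "splits_to (Suc n) d u (scale \<alpha> (bas g c) + v)"
proof (cases "\<alpha> = 0")
  case True
  then show ?thesis using rest by simp
next
  case False
  have lt: "lead_term u = (f, s)"
    using False lead by (intro lead_term_eq) (auto simp: in_keys_iff)
  have rf: "refactor (Suc n) (f, s) = (g, c)"
    using gc by (rule refactor_eq)
  have lc: "lead_coeff_tmod u = \<alpha>"
    by (simp add: lead_coeff_tmod_def lt lead)
  have nz: "u \<noteq> 0"
    using False lead by auto
  have "split_map_dom (Suc n, d, u)"
    by (rule split_map.domintros) (use rest lt rf lc in \<open>auto simp: splits_to_def\<close>)
  then show ?thesis
    using rest nz by (simp add: splits_to_def split_map.psimps lt rf lc)
qed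

section \<open>The differential on the two families of chains\<close>

text \<open>The differential maps the generator to this very term, so one step leaves remainder 0.
  In the applications \<open>c\<close> is \<tau> or 1.\<close>

lemma splits_to_e1_power:
  assumes "anick_gen \<tau> n (e1_power (Suc n)) = bas (e1_power n) [E1]"
  shows "splits_to n (anick_d \<tau> n) (scale c (bas (e1_power n) [E1]))
    (scale c (bas (e1_power (Suc n)) []))"
proof (cases n)
  case 0
  then show ?thesis using splits_to_0[of _ c E1 "[]"] by simp
next
  case (Suc m)
  have "anick_d \<tau> n (bas (e1_power (Suc n)) []) = bas (e1_power n) [E1]"
    unfolding anick_d_bas assms by (simp add: ract_simps)
  then have "splits_to (Suc m) (anick_d \<tau> n)
      (scale c (bas (e1_power n) [E1]) - scale c (anick_d \<tau> n (bas (e1_power (Suc n)) []))) 0"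
    by (simp add: splits_to_zero del: replicate_Suc)
  then have "splits_to (Suc m) (anick_d \<tau> n) (scale c (bas (e1_power n) [E1]))
      (scale c (bas (e1_power (Suc n)) []) + 0)"
    by (rule splits_to_step[where f = "e1_power n" and s = "[E1]", rotated -1])
      (use e1_power_in_anick_chains[of n] e1_power_append in
        \<open>auto simp: bas_def Suc normal_words_eq simp del: replicate_Suc split: if_splits\<close>)
  then show ?thesis
    by (simp add: Suc)
qed

text \<open>Here \<tau> enters, through the reduction of E1 E1 to \<tau> E1.\<close>

lemma anick_gen_Suc_e1_power:
  assumes "anick_gen \<tau> n (e1_power (Suc n)) = bas (e1_power n) [E1]"
  shows "anick_gen \<tau> (Suc n) (e1_power (Suc (Suc n)))
    = bas (e1_power (Suc n)) [E1] - scale \<tau> (bas (e1_power (Suc n)) [])"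
proof -
  have "anick_d \<tau> n (bas (e1_power (Suc n)) [E1]) = scale \<tau> (bas (e1_power n) [E1])"
    unfolding anick_d_bas assms by (simp add: ract_simps)
  then show ?thesis
    using anick_gen_Suc[OF e1_power_in_anick_chains[of n], of "[E1]" \<tau>] chain_e1_power[of "Suc n"]
      splits_to_e1_power[OF assms, of \<tau>]
    by (simp add: e1_power_append splits_to_def del: replicate_Suc anick_gen.simps)
qed

text \<open>E1 E2 E1 reduces to E1, so the same term is split, now with factor 1.\<close>

lemma anick_gen_Suc_e1_power_E2_E1:
  assumes "anick_gen \<tau> n (e1_power (Suc n)) = bas (e1_power n) [E1]"
  shows "anick_gen \<tau> (Suc n) (e1_power (Suc n) @ [E2, E1])
    = bas (e1_power (Suc n)) [E2, E1] - bas (e1_power (Suc n)) []"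
proof -
  have "anick_d \<tau> n (bas (e1_power (Suc n)) [E2, E1]) = bas (e1_power n) [E1]"
    unfolding anick_d_bas assms by (simp add: ract_simps)
  then show ?thesis
    using anick_gen_Suc[OF e1_power_in_anick_chains[of n] chain_e1_power_E2_E1, of \<tau>]
      splits_to_e1_power[OF assms, of 1]
    by (simp add: splits_to_def del: replicate_Suc anick_gen.simps)
qed

text \<open>E1 E1 - \<tau> E1 vanishes in the algebra, so nothing is left to split.\<close>

lemma anick_gen_Suc_Suc_e1_power:
  assumes "anick_gen \<tau> (Suc n) (e1_power (Suc (Suc n)))
    = bas (e1_power (Suc n)) [E1] - scale \<tau> (bas (e1_power (Suc n)) [])"
  shows "anick_gen \<tau> (Suc (Suc n)) (e1_power (Suc (Suc (Suc n)))) = bas (e1_power (Suc (Suc n))) [E1]"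
proof -
  have "anick_d \<tau> (Suc n) (bas (e1_power (Suc (Suc n))) [E1]) = 0"
    unfolding anick_d_bas assms by (simp add: ract_simps)
  then show ?thesis
    using anick_gen_Suc[OF e1_power_in_anick_chains[of "Suc n"], of "[E1]" \<tau>]
      chain_e1_power[of "Suc (Suc n)"] splits_to_zero[of n "anick_d \<tau> (Suc n)"]
    by (simp add: e1_power_append splits_to_def del: replicate_Suc anick_gen.simps)
qed

lemma anick_gen_Suc_Suc_e1_power_E2_E1:
  assumes "anick_gen \<tau> (Suc n) (e1_power (Suc (Suc n)))
    = bas (e1_power (Suc n)) [E1] - scale \<tau> (bas (e1_power (Suc n)) [])"
    and "anick_gen \<tau> (Suc n) (e1_power (Suc n) @ [E2, E1])
    = bas (e1_power (Suc n)) [E2, E1] - bas (e1_power (Suc n)) []"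
  shows "anick_gen \<tau> (Suc (Suc n)) (e1_power (Suc (Suc n)) @ [E2, E1])
    = bas (e1_power (Suc (Suc n))) [E2, E1]
      + scale \<tau> (bas (e1_power (Suc n) @ [E2, E1]) []) - bas (e1_power (Suc (Suc n))) []"
proof -
  let ?A = "e1_power (Suc n)" and ?A' = "e1_power (Suc (Suc n))"
  let ?d = "anick_d \<tau> (Suc n)"
  \<comment> \<open>Splitting \<open>?u\<close> goes in two stages: the word of
    \<open>bas ?A [E2, E1]\<close> is itself a chain and is removed with coefficient -\<tau>, which
    leaves \<open>?u'\<close>, the image of \<open>bas ?A' []\<close>.\<close>
  let ?u = "bas ?A [E1] - scale \<tau> (bas ?A [E2, E1])"
  let ?u' = "bas ?A [E1] - scale \<tau> (bas ?A [])"
  have d1: "?d (bas ?A' []) = ?u'"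
    unfolding anick_d_bas assms by (simp add: ract_simps)
  have d2: "?d (bas (?A @ [E2, E1]) []) = bas ?A [E2, E1] - bas ?A []"
    unfolding anick_d_bas assms by (simp add: ract_simps)
  have d3: "?d (bas ?A' [E2, E1]) = ?u"
    unfolding anick_d_bas assms by (simp add: ract_simps)
  have "splits_to (Suc n) ?d ?u' (scale 1 (bas ?A' []) + 0)"
  proof (rule splits_to_step)
    show "Poly_Mapping.lookup ?u' (?A, [E1]) = 1"
      by (simp add: bas_def lookup_minus lookup_single)
    show "length (f' @ s') < length (?A @ [E1])"
      if "(f', s') \<in> Poly_Mapping.keys ?u'" "(f', s') \<noteq> (?A, [E1])" for f' s'
      using that
      by (auto simp: bas_def lookup_minus lookup_single in_keys_iff when_def split: if_splits)
    show "splits_to (Suc n) ?d (?u' - scale 1 (?d (bas ?A' []))) 0"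
      unfolding d1 by (simp add: splits_to_zero)
  qed (use e1_power_in_anick_chains[of "Suc n"] e1_power_append in
      \<open>simp_all add: normal_words_eq del: replicate_Suc\<close>)
  then have rest: "splits_to (Suc n) ?d (?u - scale (- \<tau>) (?d (bas (?A @ [E2, E1]) []))) (bas ?A' [])"
    by (simp add: d2 scale_minus_left scale_diff del: replicate_Suc)
  have "splits_to (Suc n) ?d ?u (scale (- \<tau>) (bas (?A @ [E2, E1]) []) + bas ?A' [])"
  proof (rule splits_to_step[OF _ _ _ _ _ rest])
    show "Poly_Mapping.lookup ?u (?A, [E2, E1]) = - \<tau>"
      by (simp add: bas_def lookup_minus lookup_single)
    show "length (f' @ s') < length (?A @ [E2, E1])"
      if "(f', s') \<in> Poly_Mapping.keys ?u" "(f', s') \<noteq> (?A, [E2, E1])" for f' s'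
      using that
      by (auto simp: bas_def lookup_minus lookup_single in_keys_iff when_def split: if_splits)
  qed (use e1_power_E2_E1_in_anick_chains[of n] in \<open>simp_all add: normal_words_eq\<close>)
  then have "split_map (Suc n) ?d ?u = bas ?A' [] - scale \<tau> (bas (?A @ [E2, E1]) [])"
    by (simp add: splits_to_def scale_minus_left del: replicate_Suc)
  then show ?thesis
    unfolding anick_gen_Suc[OF e1_power_in_anick_chains[of "Suc n"] chain_e1_power_E2_E1] d3
    by (simp del: replicate_Suc)
qed

text \<open>The form at an even degree \<open>m\<close> determines the one at \<open>m + 1\<close>,
  which gives the first form back at \<open>m + 2\<close>.\<close>

lemma anick_gen_even_e1_power:
  "even n \<Longrightarrow> anick_gen \<tau> n (e1_power (Suc n)) = bas (e1_power n) [E1]"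
proof (induction n rule: less_induct)
  case (less n)
  show ?case
  proof (cases "n = 0")
    case False
    with less.prems obtain m where "n = Suc (Suc m)" "even m"
      by (cases n; cases "n - 1") auto
    then show ?thesis
      using anick_gen_Suc_Suc_e1_power[OF anick_gen_Suc_e1_power[OF less.IH[of m]]] by simp
  qed simp
qed

theorem proposition2:
  fixes n :: nat
  assumes "n \<ge> 1"
  shows "\<exists>c \<in> anick_chains n. \<exists>f \<in> anick_chains (n - 1). \<exists>s \<in> normal_words.
           \<not> (\<exists>k. \<forall>\<tau>. Poly_Mapping.lookup (anick_d \<tau> n (bas c [])) (f, s) = k)"
proof (cases "odd n")
  case True
  then obtain m where n: "n = Suc m" "even m"
    by (cases n) auto
  have "Poly_Mapping.lookup (anick_d \<tau> n (bas (e1_power (Suc n)) [])) (e1_power n, []) = - \<tau>" for \<tau>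
    unfolding anick_d_bas n(1) anick_gen_Suc_e1_power[OF anick_gen_even_e1_power[OF n(2)]]
    by (simp add: ract_simps lookup_minus) (simp add: bas_def lookup_single)
  \<comment> \<open>The values at \<tau> = 0 and \<tau> = 1 differ.\<close>
  then have "\<not> (\<exists>k. \<forall>\<tau>. Poly_Mapping.lookup (anick_d \<tau> n (bas (e1_power (Suc n)) [])) (e1_power n, []) = k)"
    by (metis neg_equal_iff_equal zero_neq_one)
  moreover have "[] \<in> normal_words"
    by (simp add: normal_words_eq)
  ultimately show ?thesis
    using e1_power_in_anick_chains[of n] e1_power_in_anick_chains[of m] n(1)
    by (metis diff_Suc_1)
next
  case False
  then obtain m where n: "n = Suc (Suc m)" "even m"
    using assms by (cases n; cases "n - 1") auto
  \<comment> \<open>\<open>?f\<close> is the chain of degree \<open>Suc m\<close>, that is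
    \<open>n - 1\<close>, which the splitting produces with coefficient -\<tau>; the differential
    subtracts it.\<close>
  let ?c = "e1_power n @ [E2, E1]" and ?f = "e1_power (Suc m) @ [E2, E1]"
  have "Poly_Mapping.lookup (anick_d \<tau> n (bas ?c [])) (?f, []) = \<tau>" for \<tau>
  proof -
    note gen_m = anick_gen_even_e1_power[OF n(2), of \<tau>]
    show ?thesis
      unfolding anick_d_bas n(1) anick_gen_Suc_Suc_e1_power_E2_E1
        [OF anick_gen_Suc_e1_power[OF gen_m] anick_gen_Suc_e1_power_E2_E1[OF gen_m]]
      by (simp add: ract_simps lookup_minus lookup_add) (simp add: bas_def lookup_single when_def)
  qed
  then have "\<not> (\<exists>k. \<forall>\<tau>. Poly_Mapping.lookup (anick_d \<tau> n (bas ?c [])) (?f, []) = k)"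
    by (metis zero_neq_one)
  moreover have "[] \<in> normal_words"
    by (simp add: normal_words_eq)
  ultimately show ?thesis
    using e1_power_E2_E1_in_anick_chains[of "Suc m"] e1_power_E2_E1_in_anick_chains[of m] n(1)
    by (metis diff_Suc_1)
qed

end
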